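(* Assume Martin's Axiom. Then there is a p-point $D$ on $\omega\times\omega$ such that its projections $\pi_1(D)$ and $\pi_2(D)$ are Tukey incomparable p-points with $\pi_1(D)<_T D$ and $\pi_2(D)<_T D$, and there is a p-point $E$ with $E<_T\pi_1(D)$ and $E<_T\pi_2(D)$.
   Context: $\pi_1,\pi_2:\omega\times\omega\to\omega$ are the coordinate projections, and $\pi_i(D)=\{X\subseteq\omega:\pi_i^{-1}(X)\in D\}$. Ultrafilters are ordered by $\supseteq$; $\mathcal{V}\le_T\mathcal{U}$ means there is a map $\mathcal{U}\to\mathcal{V}$ sending cofinal subsets to cofinal subsets; $<_T$ is its strict version; Tukey incomparable means neither is $\le_T$ the other. A p-point is a nonprincipal ultrafilter on a countable set in which every countable subfamily $\{X_n\}$ has some $X$ in the ultrafilter with $X\setminus X_n$ finite for all $n$. *)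

theory Defs
  imports
    "HOL-Library.Countable_Set"
    "HOL-Library.FuncSet"
    "HOL-Library.Equipollence"
begin

text \<open>
  A forcing poset is a nonempty carrier \<open>P\<close> with a partial order \<open>r\<close>, where
  \<open>(p, q) \<in> r\<close> reads \<open>p \<le> q\<close>, so that smaller conditions are stronger.
\<close>

definition compatible_in :: "'p set \<Rightarrow> 'p rel \<Rightarrow> 'p \<Rightarrow> 'p \<Rightarrow> bool" where
  "compatible_in P r p q \<longleftrightarrow> (\<exists>s\<in>P. (s, p) \<in> r \<and> (s, q) \<in> r)"

definition ccc_poset :: "'p set \<Rightarrow> 'p rel \<Rightarrow> bool" where
  "ccc_poset P r \<longleftrightarrow>
     (\<forall>A\<subseteq>P. (\<forall>p\<in>A. \<forall>q\<in>A. p \<noteq> q \<longrightarrow> \<not> compatible_in P r p q) \<longrightarrow> countable A)"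

definition dense_in_poset :: "'p set \<Rightarrow> 'p rel \<Rightarrow> 'p set \<Rightarrow> bool" where
  "dense_in_poset P r D \<longleftrightarrow> D \<subseteq> P \<and> (\<forall>p\<in>P. \<exists>d\<in>D. (d, p) \<in> r)"

definition filter_in_poset :: "'p set \<Rightarrow> 'p rel \<Rightarrow> 'p set \<Rightarrow> bool" where
  "filter_in_poset P r G \<longleftrightarrow>
     G \<subseteq> P \<and> G \<noteq> {} \<and>
     (\<forall>p\<in>G. \<forall>q\<in>P. (p, q) \<in> r \<longrightarrow> q \<in> G) \<and>
     (\<forall>p\<in>G. \<forall>q\<in>G. \<exists>s\<in>G. (s, p) \<in> r \<and> (s, q) \<in> r)"

text \<open>
  Martin's Axiom for all ccc posets with carrier a set of elements of type \<open>'p\<close>.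
  HOL cannot quantify over types inside a formula, so a type has to be chosen when the
  axiom is assumed. At \<open>TYPE(nat set)\<close> it covers, up to isomorphism, exactly the ccc
  posets of cardinality at most the continuum. This follows from the unrestricted axiom,
  and is well known to be equivalent to it, by passing to an elementary subposet of size
  less than the continuum.
\<close>

definition martins_axiom :: "'p itself \<Rightarrow> bool" where
  "martins_axiom _ \<longleftrightarrow>
     (\<forall>(P :: 'p set) r \<D>.
        P \<noteq> {} \<and> partial_order_on P r \<and> ccc_poset P r \<and>
        \<D> \<prec> (UNIV :: nat set set) \<and> (\<forall>D\<in>\<D>. dense_in_poset P r D) \<longrightarrow>
        (\<exists>G. filter_in_poset P r G \<and> (\<forall>D\<in>\<D>. G \<inter> D \<noteq> {})))"

definition ultrafilter :: "'a set set \<Rightarrow> bool" where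
  "ultrafilter U \<longleftrightarrow>
     UNIV \<in> U \<and> {} \<notin> U \<and>
     (\<forall>X\<in>U. \<forall>Y. X \<subseteq> Y \<longrightarrow> Y \<in> U) \<and>
     (\<forall>X\<in>U. \<forall>Y\<in>U. X \<inter> Y \<in> U) \<and>
     (\<forall>X. X \<in> U \<or> - X \<in> U)"

definition nonprincipal :: "'a set set \<Rightarrow> bool" where
  "nonprincipal U \<longleftrightarrow> (\<forall>x. {x} \<notin> U)"

definition p_point :: "('a::countable) set set \<Rightarrow> bool" where
  "p_point U \<longleftrightarrow>
     ultrafilter U \<and> nonprincipal U \<and>
     (\<forall>X :: nat \<Rightarrow> 'a set. (\<forall>n. X n \<in> U) \<longrightarrow> (\<exists>Y\<in>U. \<forall>n. finite (Y - X n)))"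

definition pushforward :: "('a \<Rightarrow> 'b) \<Rightarrow> 'a set set \<Rightarrow> 'b set set" where
  "pushforward f U = {X. f -` X \<in> U}"

text \<open>
  An ultrafilter is directed by reverse inclusion, so cofinal subfamilies are its filter
  bases. (The library's \<open>cofinal\<close> asks for strict bounds and does not apply here.)
\<close>

definition cofinal_family :: "'a set set \<Rightarrow> 'a set set \<Rightarrow> bool" where
  "cofinal_family U \<X> \<longleftrightarrow> \<X> \<subseteq> U \<and> (\<forall>A\<in>U. \<exists>X\<in>\<X>. X \<subseteq> A)"

definition tukey_le :: "'b set set \<Rightarrow> 'a set set \<Rightarrow> bool" (infix \<open>\<le>\<^sub>T\<close> 50) where
  "V \<le>\<^sub>T U \<longleftrightarrow>
     (\<exists>f \<in> U \<rightarrow> V. \<forall>\<X>. cofinal_family U \<X> \<longrightarrow> cofinal_family V (f ` \<X>))"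

definition tukey_less :: "'b set set \<Rightarrow> 'a set set \<Rightarrow> bool" (infix \<open><\<^sub>T\<close> 50) where
  "V <\<^sub>T U \<longleftrightarrow> V \<le>\<^sub>T U \<and> \<not> U \<le>\<^sub>T V"

definition tukey_incomparable :: "'b set set \<Rightarrow> 'a set set \<Rightarrow> bool" where
  "tukey_incomparable V U \<longleftrightarrow> \<not> V \<le>\<^sub>T U \<and> \<not> U \<le>\<^sub>T V"

end

theory Submission
  imports Defs
begin

text \<open>
  Partition \<open>\<omega>\<close> into infinite blocks and call \<open>A \<subseteq> \<omega> \<times> \<omega>\<close> large if it contains
  \<open>k \<times> k\<close> rectangles, with both sides in one block, for every \<open>k\<close> and in arbitrarily late
  blocks. Being large is partition regular (bipartite Ramsey), and by Martin's Axiom every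
  chain of fewer than continuum many large sets, ordered by almost inclusion, has a large
  pseudo-intersection. A descending tower of large sets of length continuum can therefore
  decide all sequences of sets, so that it generates a p-point \<open>D\<close>, and can meet
  continuum many further requirements.

  Those requirements destroy all possible Tukey reductions between the two projections. As
  the projections are p-points, such a reduction is witnessed by a monotone map coded by a
  real, and every large set can be shrunk so that a given monotone map witnesses no reduction.
  Almost everywhere both projections lie in the same block, hence have the same image \<open>E\<close>
  under the map sending a point to its block. All strict inequalities follow from
  incomparability by transitivity.
\<close>

subsection \<open>Large sets\<close>

text \<open>The blocks are the fibres of this map. The pairing bijection makes all of them infinite,
  so rectangles of every size fit into every block.\<close>

definition block :: "nat \<Rightarrow> nat" where
  "block x = fst (prod_decode x)"

definition has_rect :: "nat \<Rightarrow> nat \<Rightarrow> (nat \<times> nat) set \<Rightarrow> bool" where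
  "has_rect k n A \<longleftrightarrow>
     (\<exists>a b. finite a \<and> finite b \<and> k \<le> card a \<and> k \<le> card b \<and> a \<times> b \<subseteq> A \<and>
        a \<subseteq> block -` {n} \<and> b \<subseteq> block -` {n})"

text \<open>The same \<open>k\<close> bounds side lengths and block index from below, so the
  rectangles grow while they move to late blocks.\<close>

definition large :: "(nat \<times> nat) set \<Rightarrow> bool" where
  "large A \<longleftrightarrow> (\<forall>k. \<exists>n\<ge>k. has_rect k n A)"

lemma has_rect_mono: "has_rect k n A \<Longrightarrow> j \<le> k \<Longrightarrow> A \<subseteq> B \<Longrightarrow> has_rect j n B"
  unfolding has_rect_def by (meson le_trans subset_trans)

lemma large_mono: "large A \<Longrightarrow> A \<subseteq> B \<Longrightarrow> large B"
  unfolding large_def by (meson has_rect_mono order_refl)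

lemma has_rect_diff:
  assumes "has_rect k n A" and "\<And>z. z \<in> A - B \<Longrightarrow> block (fst z) \<noteq> n"
  shows "has_rect k n B"
proof -
  obtain a b where ab: "finite a" "finite b" "k \<le> card a" "k \<le> card b" "a \<times> b \<subseteq> A"
    "a \<subseteq> block -` {n}" "b \<subseteq> block -` {n}"
    using assms(1) unfolding has_rect_def by blast
  then have "a \<times> b \<subseteq> B" using assms(2) by fastforce
  with ab show ?thesis unfolding has_rect_def by blast
qed

text \<open>A finite difference meets only finitely many blocks, and a large set has its rectangles
  in arbitrarily late ones.\<close>

lemma large_almost_mono:
  assumes "large A" "finite (A - B)"
  shows "large B"
  unfolding large_def
proof
  fix k
  define F where "F = (block \<circ> fst) ` (A - B)"
  have "finite F" using assms(2) by (simp add: F_def)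
  then obtain M where M: "\<forall>x\<in>F. x \<le> M" using finite_nat_set_iff_bounded_le by blast
  obtain n where n: "n \<ge> max k (Suc M)" "has_rect (max k (Suc M)) n A"
    using assms(1) unfolding large_def by blast
  have "block (fst z) \<noteq> n" if "z \<in> A - B" for z
  proof -
    have "block (fst z) \<le> M" using M that by (auto simp: F_def)
    then show ?thesis using n(1) by auto
  qed
  then have "has_rect (max k (Suc M)) n B" by (rule has_rect_diff[OF n(2)])
  then show "\<exists>n\<ge>k. has_rect k n B"
    using n(1) has_rect_mono[of _ n B k B] by auto
qed

lemma infinite_block_fibre: "infinite (block -` {n})"
proof -
  have "inj (\<lambda>i. prod_encode (n, i))" by (auto simp: inj_on_def)
  moreover have "range (\<lambda>i. prod_encode (n, i)) \<subseteq> block -` {n}" by (auto simp: block_def)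
  ultimately show ?thesis using finite_imageD infinite_UNIV_nat rev_finite_subset by metis
qed

lemma large_UNIV: "large UNIV"
  unfolding large_def
proof
  fix k
  obtain a where "finite a" "card a = k" "a \<subseteq> block -` {k}"
    using infinite_arbitrarily_large[OF infinite_block_fibre] by metis
  then show "\<exists>n\<ge>k. has_rect k n UNIV" unfolding has_rect_def by blast
qed

text \<open>Symmetry of the coordinates: each statement about one direction between the projections
  can be reused for the other direction.\<close>

lemma large_swap:
  assumes "large A"
  shows "large (prod.swap ` A)"
  unfolding large_def
proof
  fix k
  obtain n where n: "n \<ge> k" "has_rect k n A" using assms unfolding large_def by blast
  then obtain a b where ab: "finite a" "finite b" "k \<le> card a" "k \<le> card b" "a \<times> b \<subseteq> A"
    "a \<subseteq> block -` {n}" "b \<subseteq> block -` {n}" unfolding has_rect_def by blast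
  have "b \<times> a \<subseteq> prod.swap ` A" using ab(5) by force
  with ab n(1) show "\<exists>n\<ge>k. has_rect k n (prod.swap ` A)" unfolding has_rect_def by blast
qed

text \<open>A column holds no rectangle with two different first coordinates. Hence an ultrafilter
  of large sets and its first projection are nonprincipal.\<close>

lemma not_large_singleton: "\<not> large (A \<inter> {x} \<times> UNIV)"
proof
  assume "large (A \<inter> {x} \<times> UNIV)"
  then obtain n where "has_rect 2 n (A \<inter> {x} \<times> UNIV)" unfolding large_def by blast
  then obtain a b :: "nat set" where ab: "finite a" "2 \<le> card a" "2 \<le> card b" "a \<times> b \<subseteq> {x} \<times> UNIV"
    unfolding has_rect_def by blast
  from ab(3) have "b \<noteq> {}" by auto
  with ab(4) have "a \<subseteq> {x}" by auto
  then have "card a \<le> card {x}" by (intro card_mono) auto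
  with ab(2) show False by simp
qed

text \<open>Large sets have rectangles in blocks beyond \<open>n\<close>. This makes the common
  image of the two projections nonprincipal.\<close>

lemma not_large_fibre: "\<not> large {z. block (fst z) = n}"
proof
  assume "large {z. block (fst z) = n}"
  then obtain m where "m \<ge> Suc n" "has_rect (Suc n) m {z. block (fst z) = n}"
    unfolding large_def by blast
  moreover from this obtain a b :: "nat set" where ab: "Suc n \<le> card a" "Suc n \<le> card b"
    "a \<times> b \<subseteq> {z. block (fst z) = n}" "a \<subseteq> block -` {m}"
    unfolding has_rect_def by blast
  then have "a \<noteq> {}" "b \<noteq> {}" by auto
  then obtain x y where "x \<in> a" "y \<in> b" by blast
  then have "block x = n" "block x = m" using ab(3,4) by auto
  ultimately show False by simp
qed

text \<open>Both sides of a rectangle lie in one block. Hence an ultrafilter of large sets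
  concentrates on pairs whose coordinates share a block.\<close>

lemma not_large_off_diagonal: "\<not> large {z. block (fst z) \<noteq> block (snd z)}"
proof
  assume "large {z. block (fst z) \<noteq> block (snd z)}"
  then obtain n where "has_rect 1 n {z. block (fst z) \<noteq> block (snd z)}"
    unfolding large_def by blast
  then obtain a b where ab: "1 \<le> card a" "1 \<le> card b"
    "a \<times> b \<subseteq> {z. block (fst z) \<noteq> block (snd z)}" "a \<subseteq> block -` {n}" "b \<subseteq> block -` {n}"
    unfolding has_rect_def by blast
  then have "a \<noteq> {}" "b \<noteq> {}" by auto
  then obtain x y where "x \<in> a" "y \<in> b" by blast
  then show False using ab by fastforce
qed

section \<open>Partition regularity of largeness\<close>

text \<open>Pigeonhole: fix \<open>2 * k\<close> points \<open>c\<close> of \<open>a\<close> and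
  sort the points of \<open>b\<close> by their trace \<open>v y\<close> on \<open>c\<close>. Some
  trace \<open>S\<close> is shared by \<open>k\<close> points of \<open>b\<close>, and one of
  \<open>S\<close> and \<open>c - S\<close> has \<open>k\<close> elements.\<close>

lemma bipartite_ramsey:
  fixes k :: nat
  shows "\<exists>K. \<forall>(a :: 'a set) (b :: 'b set). finite a \<and> finite b \<and> K \<le> card a \<and> K \<le> card b \<and> a \<times> b \<subseteq> A \<union> B
     \<longrightarrow> (\<exists>a' \<subseteq> a. \<exists>b' \<subseteq> b. k \<le> card a' \<and> k \<le> card b' \<and> (a' \<times> b' \<subseteq> A \<or> a' \<times> b' \<subseteq> B))"
proof -
  \<comment> \<open>The first summand provides the \<open>2 * k\<close> points of \<open>c\<close>.
    The rest exceeds \<open>k\<close> times the number of possible traces.\<close>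
  let ?K = "2 * k + 2 ^ (2 * k) * k + 1"
  have "\<exists>a' \<subseteq> a. \<exists>b' \<subseteq> b. k \<le> card a' \<and> k \<le> card b' \<and> (a' \<times> b' \<subseteq> A \<or> a' \<times> b' \<subseteq> B)"
    if fin: "finite a" "finite b" and cards: "?K \<le> card a" "?K \<le> card b" and sub: "a \<times> b \<subseteq> A \<union> B"
    for a :: "'a set" and b :: "'b set"
  proof -
    obtain c where c: "c \<subseteq> a" "card c = 2 * k" "finite c"
      using obtain_subset_with_card_n[of "2 * k" a] cards(1) by auto
    define v where "v y = {x \<in> c. (x, y) \<in> A}" for y
    have "\<exists>S\<in>Pow c. k \<le> card {y \<in> b. v y = S}"
    proof (rule ccontr)
      assume none: "\<not> ?thesis"
      have small: "card {y \<in> b. v y = S} \<le> k" if "S \<in> Pow c" for S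
      proof -
        have "\<not> k \<le> card {y \<in> b. v y = S}" using none that by blast
        then show ?thesis by simp
      qed
      have "v y \<in> Pow c" for y by (auto simp: v_def)
      then have "(\<Union>S\<in>Pow c. {y \<in> b. v y = S}) = b" by blast
      then have "card b \<le> (\<Sum>S\<in>Pow c. card {y \<in> b. v y = S})"
        using card_UN_le[of "Pow c" "\<lambda>S. {y \<in> b. v y = S}"] c(3) by simp
      also have "\<dots> \<le> (\<Sum>S\<in>Pow c. k)" using small by (intro sum_mono) auto
      also have "\<dots> = 2 ^ (2 * k) * k" using c by (simp add: card_Pow)
      finally show False using cards(2) by simp
    qed
    then obtain S where S: "S \<subseteq> c" "k \<le> card {y \<in> b. v y = S}" by blast
    have "card S + card (c - S) = 2 * k"
      using c S(1) by (metis card_Diff_subset card_mono finite_subset le_add_diff_inverse)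
    then consider "k \<le> card S" | "k \<le> card (c - S)" by linarith
    then show ?thesis
    proof cases
      case 1
      moreover have "S \<times> {y \<in> b. v y = S} \<subseteq> A" by (auto simp: v_def)
      moreover have "S \<subseteq> a" using S(1) c(1) by blast
      ultimately show ?thesis using S(2) by (intro exI[of _ S] exI[of _ "{y \<in> b. v y = S}"] conjI) auto
    next
      case 2
      moreover have "(c - S) \<times> {y \<in> b. v y = S} \<subseteq> B" using sub c(1) by (auto simp: v_def)
      moreover have "c - S \<subseteq> a" using c(1) by blast
      ultimately show ?thesis using S(2) by (intro exI[of _ "c - S"] exI[of _ "{y \<in> b. v y = S}"] conjI) auto
    qed
  qed
  then show ?thesis by blast
qed

text \<open>If neither part is large, a common \<open>k\<close> rules out rectangles of side
  \<open>k\<close> in late blocks for both parts. A big late rectangle in the union contradicts this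
  by the Ramsey lemma.\<close>

lemma large_Un:
  assumes "large (A \<union> B)"
  shows "large A \<or> large B"
proof (rule ccontr)
  assume "\<not> ?thesis"
  then obtain k0 k1 where k0: "\<And>n. n \<ge> k0 \<Longrightarrow> \<not> has_rect k0 n A"
    and k1: "\<And>n. n \<ge> k1 \<Longrightarrow> \<not> has_rect k1 n B"
    unfolding large_def by blast
  define k where "k = max k0 k1"
  obtain K where K: "\<And>(a :: nat set) (b :: nat set). \<lbrakk>finite a; finite b; K \<le> card a; K \<le> card b; a \<times> b \<subseteq> A \<union> B\<rbrakk>
     \<Longrightarrow> \<exists>a' \<subseteq> a. \<exists>b' \<subseteq> b. k \<le> card a' \<and> k \<le> card b' \<and> (a' \<times> b' \<subseteq> A \<or> a' \<times> b' \<subseteq> B)"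
    using bipartite_ramsey[of A B k] by metis
  obtain n where n: "n \<ge> max K k" "has_rect (max K k) n (A \<union> B)"
    using assms unfolding large_def by blast
  then obtain a b where ab: "finite a" "finite b" "K \<le> card a" "K \<le> card b" "a \<times> b \<subseteq> A \<union> B"
    "a \<subseteq> block -` {n}" "b \<subseteq> block -` {n}" unfolding has_rect_def by auto
  obtain a' b' where ab': "a' \<subseteq> a" "b' \<subseteq> b" "k \<le> card a'" "k \<le> card b'" "a' \<times> b' \<subseteq> A \<or> a' \<times> b' \<subseteq> B"
    using K[OF ab(1-5)] by blast
  have "finite a'" "finite b'" "a' \<subseteq> block -` {n}" "b' \<subseteq> block -` {n}"
    using ab ab' finite_subset by blast+
  then have "has_rect k n A \<or> has_rect k n B" using ab' unfolding has_rect_def by blast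
  then have "has_rect k0 n A \<or> has_rect k1 n B"
    unfolding k_def using has_rect_mono by (metis max.cobounded1 max.cobounded2 order_refl)
  then show False using k0 k1 n(1) by (auto simp: k_def)
qed

section \<open>Shrinking a large set against a monotone map\<close>

text \<open>Two ways in which \<open>A \<in> D\<close> can stop \<open>g\<close> from reducing the
  second projection of \<open>D\<close> to the first, if all members of \<open>D\<close> are large:
  \<open>g\<close> sends a member of the first projection to a set disjoint from a member of the
  second, or no member of the first projection is sent below the given member of the second.\<close>

definition avoids :: "(nat set \<Rightarrow> nat set) \<Rightarrow> (nat \<times> nat) set \<Rightarrow> bool" where
  "avoids g A \<longleftrightarrow>
     g (fst ` A) \<inter> snd ` A = {} \<or> (\<forall>Y. large (A \<inter> Y \<times> UNIV) \<longrightarrow> \<not> g Y \<subseteq> snd ` A)"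

text \<open>A requirement that has been met survives further shrinking, so several can be met one
  after another.\<close>

lemma avoids_subset:
  assumes "mono g" "avoids g A" "B \<subseteq> A"
  shows "avoids g B"
proof -
  have "g (fst ` B) \<subseteq> g (fst ` A)"
    by (intro monoD[OF assms(1)] image_mono assms(3))
  moreover have "snd ` B \<subseteq> snd ` A" using assms(3) by blast
  moreover have "large (A \<inter> Y \<times> UNIV)" if "large (B \<inter> Y \<times> UNIV)" for Y
    using that by (rule large_mono) (use assms(3) in auto)
  ultimately show ?thesis
    using assms(2) unfolding avoids_def by (elim disjE) (rule disjI1, blast, rule disjI2, meson subset_trans)
qed

text \<open>By dependent choice each rectangle is taken in a later block than the one before it.
  Distinct blocks keep the rectangles disjoint in both coordinates.\<close>

lemma large_rectangles:
  assumes "large A"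
  obtains n :: "nat \<Rightarrow> nat" and a b :: "nat \<Rightarrow> nat set" where "strict_mono n"
    "\<And>k. finite (a k)" "\<And>k. finite (b k)" "\<And>k. card (a k) = k" "\<And>k. card (b k) = k"
    "\<And>k. a k \<subseteq> block -` {n k}" "\<And>k. b k \<subseteq> block -` {n k}" "\<And>k. a k \<times> b k \<subseteq> A"
proof -
  define r where "r k n \<longleftrightarrow> has_rect k n A" for k n
  have "\<exists>n. \<forall>k. r k (n k) \<and> n k < n (Suc k)"
  proof (rule dependent_nat_choice)
    show "\<exists>x. r 0 x" using assms unfolding large_def r_def by blast
    fix x k
    obtain m where "m \<ge> max (Suc x) (Suc k)" "has_rect (max (Suc x) (Suc k)) m A"
      using assms unfolding large_def by blast
    then show "\<exists>y. r (Suc k) y \<and> x < y"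
      unfolding r_def using has_rect_mono[of _ m A "Suc k" A] by (intro exI[of _ m]) auto
  qed
  then obtain n where n: "\<And>k. has_rect k (n k) A" "strict_mono n"
    unfolding r_def strict_mono_Suc_iff by blast
  have "\<exists>a b. finite a \<and> finite b \<and> card a = k \<and> card b = k \<and> a \<subseteq> block -` {n k} \<and>
      b \<subseteq> block -` {n k} \<and> a \<times> b \<subseteq> A" for k
  proof -
    obtain a b where ab: "k \<le> card a" "k \<le> card b" "a \<times> b \<subseteq> A"
      "a \<subseteq> block -` {n k}" "b \<subseteq> block -` {n k}"
      using n(1)[of k] unfolding has_rect_def by blast
    obtain a' where a': "a' \<subseteq> a" "card a' = k" "finite a'"
      using obtain_subset_with_card_n[OF ab(1)] .
    obtain b' where b': "b' \<subseteq> b" "card b' = k" "finite b'"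
      using obtain_subset_with_card_n[OF ab(2)] .
    have "a' \<times> b' \<subseteq> A" "a' \<subseteq> block -` {n k}" "b' \<subseteq> block -` {n k}"
      using a'(1) b'(1) ab(3-5) by blast+
    with a' b' show ?thesis by blast
  qed
  then obtain a b where "\<And>k. finite (a k) \<and> finite (b k) \<and> card (a k) = k \<and> card (b k) = k \<and>
      a k \<subseteq> block -` {n k} \<and> b k \<subseteq> block -` {n k} \<and> a k \<times> b k \<subseteq> A"
    by metis
  then show ?thesis using n(2) by (intro that[of n a b]) simp_all
qed

text \<open>
  Inside a union of rectangles \<open>a k \<times> b k\<close>, either some \<open>Y\<close> leaves unboundedly much of
  \<open>b k\<close> outside \<open>g Y\<close>, and then the two projections can be separated by \<open>g\<close>; or \<open>g Y\<close>
  always swallows all but a bounded part of \<open>b k\<close>, so that halving every \<open>b k\<close> makes it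
  too small to contain any \<open>g Y\<close>.
\<close>

lemma large_avoids:
  assumes "large A" "mono g"
  shows "\<exists>B\<subseteq>A. large B \<and> avoids g B"
proof -
  obtain n a b where n: "strict_mono n"
    and fin: "\<And>k. finite (a k)" "\<And>k. finite (b k)"
    and card: "\<And>k. card (a k) = k" "\<And>k. card (b k) = k"
    and blk: "\<And>k. a k \<subseteq> block -` {n k}" "\<And>k. b k \<subseteq> block -` {n k}"
    and sub: "\<And>k. a k \<times> b k \<subseteq> A"
    by (rule large_rectangles[OF assms(1)]) (rule that)
  have large_UN: "large (\<Union>k. c k \<times> d k)"
    if cd: "\<And>k. c k \<subseteq> a k" "\<And>k. d k \<subseteq> b k" "\<And>m. \<exists>k. m \<le> card (c k) \<and> m \<le> card (d k)" for c d
    unfolding large_def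
  proof
    fix m
    obtain k where k: "m \<le> card (c k)" "m \<le> card (d k)" using cd(3) by blast
    \<comment> \<open>As \<open>k \<le> n k\<close>, a piece with \<open>m\<close> points on a side
      sits in a block of index at least \<open>m\<close>.\<close>
    have "card (c k) \<le> k" using card_mono[OF fin(1) cd(1)] card(1) by metis
    then have "m \<le> n k" using k(1) strict_mono_imp_increasing[OF n, of k] by linarith
    moreover have "has_rect m (n k) (\<Union>k. c k \<times> d k)"
      unfolding has_rect_def
    proof (intro exI conjI)
      show "finite (c k)" "finite (d k)"
        using cd(1,2) fin finite_subset by metis+
      show "c k \<subseteq> block -` {n k}" "d k \<subseteq> block -` {n k}"
        using cd(1,2)[of k] blk[of k] by blast+
    qed (use k in auto)
    ultimately show "\<exists>n\<ge>m. has_rect m n (\<Union>k. c k \<times> d k)" by blast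
  qed
  show ?thesis
  proof (cases "\<exists>Y. \<forall>m. \<exists>k. m \<le> card (Y \<inter> a k) \<and> m \<le> card (b k - g Y)")
    case True
    then obtain Y where Y: "\<And>m. \<exists>k. m \<le> card (Y \<inter> a k) \<and> m \<le> card (b k - g Y)" by blast
    let ?B = "\<Union>k. (Y \<inter> a k) \<times> (b k - g Y)"
    have "large ?B" using Y by (intro large_UN) auto
    moreover have "g (fst ` ?B) \<subseteq> g Y" by (rule monoD[OF assms(2)]) auto
    then have "avoids g ?B" unfolding avoids_def by auto
    moreover have "?B \<subseteq> A" using sub by blast
    ultimately show ?thesis by blast
  next
    case False
    have "\<exists>d\<subseteq>b k. card d = k div 2" for k
      using obtain_subset_with_card_n[of "k div 2" "b k"] card(2) by (metis div_le_dividend)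
    then obtain d where d: "\<And>k. d k \<subseteq> b k" "\<And>k. card (d k) = k div 2" by metis
    let ?B = "\<Union>k. a k \<times> d k"
    have "large ?B"
    proof (rule large_UN)
      fix m show "\<exists>k. m \<le> card (a k) \<and> m \<le> card (d k)"
        by (rule exI[of _ "2 * m"]) (simp add: card d)
    qed (use d in auto)
    moreover have "\<not> g Y \<subseteq> snd ` ?B" if lg: "large (?B \<inter> Y \<times> UNIV)" for Y
    proof
      assume gY: "g Y \<subseteq> snd ` ?B"
      obtain m where m: "\<And>k. card (Y \<inter> a k) < m \<or> card (b k - g Y) < m"
        using False by (meson not_le)
      obtain N where "N \<ge> Suc m" "has_rect (Suc m) N (?B \<inter> Y \<times> UNIV)"
        using lg unfolding large_def by blast
      then obtain p q where pq: "finite p" "finite q" "m < card p" "m < card q"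
        "p \<times> q \<subseteq> ?B \<inter> Y \<times> UNIV" "p \<subseteq> block -` {N}"
        unfolding has_rect_def by (auto simp: Suc_le_eq)
      then have "p \<noteq> {}" "q \<noteq> {}" by auto
      then obtain x0 y0 where x0: "x0 \<in> p" and y0: "y0 \<in> q" by blast
      \<comment> \<open>Different indices belong to different blocks, so the rectangle
        \<open>p \<times> q\<close> inside the block \<open>N\<close> comes from a single index
        \<open>k\<close>.\<close>
      with pq(5) obtain k where k: "x0 \<in> a k" by blast
      have "block x0 = n k" "block x0 = N" using k blk(1) pq(6) x0 by blast+
      then have nk: "n k = N" by simp
      have uniq: "j = k" if "x \<in> p" "x \<in> a j" for x j
      proof -
        have "block x = n j" "block x = N" using that blk(1) pq(6) by blast+
        then show ?thesis using nk n by (metis strict_mono_eq)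
      qed
      have pk: "x \<in> a k \<and> y \<in> d k \<and> x \<in> Y" if "x \<in> p" "y \<in> q" for x y
        using pq(5) that uniq by blast
      have "p \<subseteq> Y \<inter> a k" using pk y0 by blast
      then have "card p \<le> card (Y \<inter> a k)" using fin by (intro card_mono) auto
      then have "card (b k - g Y) < m" using m[of k] pq(3) by linarith
      moreover have "q \<subseteq> d k" using pk x0 by blast
      then have "card q \<le> k div 2" using d fin by (metis card_mono finite_subset)
      \<comment> \<open>Within the block \<open>n k\<close>, the second projection of
        \<open>?B\<close> consists of \<open>d k\<close> only, and it contains
        \<open>g Y\<close>.\<close>
      moreover have "b k - d k \<subseteq> b k - g Y"
      proof
        fix y assume y: "y \<in> b k - d k"
        have "y \<notin> g Y"
        proof
          assume "y \<in> g Y"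
          then obtain j where j: "y \<in> d j" using gY by auto
          then have "block y = n j" "block y = n k" using d(1) blk(2) y by blast+
          then have "j = k" using n by (metis strict_mono_eq)
          with j y show False by simp
        qed
        with y show "y \<in> b k - g Y" by blast
      qed
      then have "card (b k - d k) \<le> card (b k - g Y)" using fin by (intro card_mono) auto
      moreover have "card (b k - d k) = k - k div 2"
        using card_Diff_subset[of "d k" "b k"] d fin card by (metis finite_subset)
      \<comment> \<open>The estimates give \<open>k - k div 2 < m\<close> and
        \<open>m < card q \<le> k div 2\<close>, which is impossible.\<close>
      ultimately show False using pq(4) by linarith
    qed
    moreover have "?B \<subseteq> A" using sub d(1) by blast
    ultimately show ?thesis unfolding avoids_def by blast
  qed
qed

subsection \<open>Pseudo-intersections from Martin's Axiom\<close>

lemma martins_axiomD: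
  fixes P :: "'p set"
  assumes "martins_axiom TYPE('p)" "P \<noteq> {}" "partial_order_on P r" "ccc_poset P r"
    "\<D> \<prec> (UNIV :: nat set set)" "\<forall>D\<in>\<D>. dense_in_poset P r D"
  shows "\<exists>G. filter_in_poset P r G \<and> (\<forall>D\<in>\<D>. G \<inter> D \<noteq> {})"
  using assms(1)[unfolded martins_axiom_def, rule_format, of P r \<D>] assms(2-) by simp

text \<open>The poset is copied along \<open>e\<close>, and the generic filter of the copy is pulled
  back. This makes the axiom available for conditions that are pairs.\<close>

lemma martins_axiom_inj:
  fixes e :: "'b \<Rightarrow> 'a"
  assumes MA: "martins_axiom TYPE('a)" and e: "inj e"
  shows "martins_axiom TYPE('b)"
  unfolding martins_axiom_def
proof (intro allI impI, elim conjE)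
  fix P :: "'b set" and r \<D>
  assume P: "P \<noteq> {}" and po: "partial_order_on P r" and ccc: "ccc_poset P r"
    and small: "\<D> \<prec> (UNIV :: nat set set)" and dense: "\<forall>D\<in>\<D>. dense_in_poset P r D"
  define r' where "r' = map_prod e e ` r"
  have r': "(e x, e y) \<in> r' \<longleftrightarrow> (x, y) \<in> r" for x y
    using e by (auto simp: r'_def inj_def)
  have r'D: "\<exists>x y. u = e x \<and> v = e y \<and> (x, y) \<in> r" if "(u, v) \<in> r'" for u v
    using that by (auto simp: r'_def)
  have rP: "r \<subseteq> P \<times> P" and "refl_on P r" "trans r" "antisym r"
    using po by (auto simp: partial_order_on_def preorder_on_def)
  have "partial_order_on (e ` P) r'"
    unfolding partial_order_on_def preorder_on_def
  proof (intro conjI)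
    show "r' \<subseteq> e ` P \<times> e ` P" using rP by (auto simp: r'_def)
    show "refl_on (e ` P) r'" using \<open>refl_on P r\<close> by (auto simp: refl_on_def r')
    show "trans r'"
      using \<open>trans r\<close> e by (auto simp: trans_def r'_def inj_def) blast
    show "antisym r'"
      using \<open>antisym r\<close> e by (auto simp: antisym_def r'_def inj_def)
  qed
  moreover have "ccc_poset (e ` P) r'"
    unfolding ccc_poset_def
  proof (intro allI impI)
    fix A assume A: "A \<subseteq> e ` P"
      and anti: "\<forall>p\<in>A. \<forall>q\<in>A. p \<noteq> q \<longrightarrow> \<not> compatible_in (e ` P) r' p q"
    obtain B where B: "B \<subseteq> P" "A = e ` B" using A by (auto simp: subset_image_iff)
    have "\<not> compatible_in P r p q" if "p \<in> B" "q \<in> B" "p \<noteq> q" for p q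
    proof
      assume "compatible_in P r p q"
      then have "compatible_in (e ` P) r' (e p) (e q)"
        by (auto simp: compatible_in_def r')
      then show False using anti that B(2) e by (auto simp: inj_def)
    qed
    then have "countable B" using ccc B(1) unfolding ccc_poset_def by blast
    then show "countable A" using B(2) by simp
  qed
  moreover have "(`) e ` \<D> \<prec> (UNIV :: nat set set)"
    using image_lepoll small lesspoll_trans1 by blast
  moreover have "\<forall>D\<in>(`) e ` \<D>. dense_in_poset (e ` P) r' D"
    using dense by (fastforce simp: dense_in_poset_def r')
  ultimately obtain G where G: "filter_in_poset (e ` P) r' G" "\<forall>D\<in>(`) e ` \<D>. G \<inter> D \<noteq> {}"
    using MA P unfolding martins_axiom_def by (metis image_is_empty)
  define H where "H = e -` G"
  have GP: "G \<subseteq> e ` P" using G(1) by (simp add: filter_in_poset_def)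
  then have GH: "G = e ` H" by (auto simp: H_def)
  have "filter_in_poset P r H"
    unfolding filter_in_poset_def
  proof (intro conjI ballI impI)
    show "H \<subseteq> P" using GP e by (auto simp: H_def inj_def)
    show "H \<noteq> {}" using G(1) GH by (auto simp: filter_in_poset_def)
  next
    fix p q assume "p \<in> H" "q \<in> P" "(p, q) \<in> r"
    then have "e p \<in> G" "e q \<in> e ` P" "(e p, e q) \<in> r'" by (auto simp: H_def r')
    then have "e q \<in> G" using G(1) unfolding filter_in_poset_def by blast
    then show "q \<in> H" by (simp add: H_def)
  next
    fix p q assume "p \<in> H" "q \<in> H"
    then have "e p \<in> G" "e q \<in> G" by (auto simp: H_def)
    then obtain s where "s \<in> G" "(s, e p) \<in> r'" "(s, e q) \<in> r'"
      using G(1) unfolding filter_in_poset_def by blast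
    then show "\<exists>s\<in>H. (s, p) \<in> r \<and> (s, q) \<in> r" using GH r' by auto
  qed
  moreover have "H \<inter> D \<noteq> {}" if "D \<in> \<D>" for D
    using G(2) that by (fastforce simp: H_def)
  ultimately show "\<exists>G. filter_in_poset P r G \<and> (\<forall>D\<in>\<D>. G \<inter> D \<noteq> {})" by blast
qed

text \<open>A pair of sets is coded by the disjoint sum of its components, mapped into the
  naturals.\<close>

lemma martins_axiom_pairs:
  assumes "martins_axiom TYPE(nat set)"
  shows "martins_axiom TYPE('a::countable set \<times> 'b::countable set)"
proof (rule martins_axiom_inj[OF assms])
  show "inj (\<lambda>p :: 'a set \<times> 'b set. (to_nat :: 'a + 'b \<Rightarrow> nat) ` (fst p <+> snd p))"
  proof (rule injI)
    fix p q :: "'a set \<times> 'b set"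
    assume "(to_nat :: 'a + 'b \<Rightarrow> nat) ` (fst p <+> snd p) = to_nat ` (fst q <+> snd q)"
    then have "fst p <+> snd p = fst q <+> snd q" by (simp add: inj_image_eq_iff)
    moreover have "Inl -` (A <+> B) = A" "Inr -` (A <+> B) = B" for A :: "'a set" and B :: "'b set"
      by auto
    ultimately show "p = q" by (metis prod_eqI)
  qed
qed

text \<open>Bridge to cardinals as well-orders, where unions and proper initial segments have known
  size bounds.\<close>

lemma lesspoll_iff_ordLess: "A \<prec> B \<longleftrightarrow> (card_of A, card_of B) \<in> ordLess"
  unfolding lesspoll_def lepoll_def eqpoll_iff_card_of_ordIso card_of_ordLeq
  by (metis not_ordLess_ordLeq ordIso_iff_ordLeq ordLeq_iff_ordLess_or_ordIso)

lemma lesspoll_Un: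
  assumes "infinite C" "A \<prec> C" "B \<prec> C"
  shows "A \<union> B \<prec> C"
  using assms card_of_Un_ordLess_infinite unfolding lesspoll_iff_ordLess by blast

lemma countable_lesspoll_uncountable: "countable A \<Longrightarrow> uncountable B \<Longrightarrow> A \<prec> B"
  unfolding lesspoll_iff_ordLess
  by (metis card_of_ordLess2 card_of_ordLeq countable_lepoll lepoll_def card_of_Well_order not_ordLeq_iff_ordLess)

lemma uncountable_nat_sets: "uncountable (UNIV :: nat set set)"
  using Cantors_theorem[of "UNIV :: nat set"] by (auto simp: uncountable_def)

lemma almost_subset_trans:
  "finite (A - B) \<Longrightarrow> finite (B - C) \<Longrightarrow> finite (A - C)"
  by (rule finite_subset[of _ "(A - B) \<union> (B - C)"]) auto

text \<open>
  Mathias-type forcing: a condition \<open>(s, A)\<close> promises that the pseudo-intersection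
  extends \<open>s\<close> by elements of \<open>A\<close> only. Conditions with the same \<open>s\<close> are compatible,
  so the poset is \<open>\<sigma>\<close>-centred.
\<close>

lemma large_pseudo_intersection:
  assumes MA: "martins_axiom TYPE(nat set)"
    and small: "\<F> \<prec> (UNIV :: nat set set)"
    and large: "\<And>A. A \<in> \<F> \<Longrightarrow> large A"
    and chain: "\<And>A B. A \<in> \<F> \<Longrightarrow> B \<in> \<F> \<Longrightarrow> finite (A - B) \<or> finite (B - A)"
  shows "\<exists>C. large C \<and> (\<forall>A\<in>\<F>. finite (C - A))"
proof (cases "\<F> = {}")
  case True
  then show ?thesis using large_UNIV by blast
next
  case False
  \<comment> \<open>The upward closure under almost inclusion keeps all members large and, as
    \<open>\<F>\<close> is a chain, is closed under intersection. It supplies the side conditions of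
    the forcing.\<close>
  define \<G> where "\<G> = {A. \<exists>B\<in>\<F>. finite (B - A)}"
  have \<G>_large: "large A" if "A \<in> \<G>" for A
    using that large large_almost_mono by (auto simp: \<G>_def)
  have \<G>_Int: "A \<inter> B \<in> \<G>" if AB: "A \<in> \<G>" "B \<in> \<G>" for A B
  proof -
    obtain A' B' where A': "A' \<in> \<F>" "finite (A' - A)" and B': "B' \<in> \<F>" "finite (B' - B)"
      using AB by (auto simp: \<G>_def)
    from chain[OF A'(1) B'(1)] show ?thesis
    proof
      assume "finite (A' - B')"
      then have "finite (A' - B)" using B'(2) almost_subset_trans by blast
      then have "finite (A' - A \<inter> B)" using A'(2) by (simp add: Diff_Int)
      then show ?thesis using A'(1) by (auto simp: \<G>_def)
    next
      assume "finite (B' - A')"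
      then have "finite (B' - A)" using A'(2) almost_subset_trans by blast
      then have "finite (B' - A \<inter> B)" using B'(2) by (simp add: Diff_Int)
      then show ?thesis using B'(1) by (auto simp: \<G>_def)
    qed
  qed
  have \<F>\<G>: "\<F> \<subseteq> \<G>"
  proof
    fix A assume "A \<in> \<F>"
    moreover have "finite (A - A)" by simp
    ultimately show "A \<in> \<G>" unfolding \<G>_def by blast
  qed
  define P where "P = {(s :: (nat \<times> nat) set, A). finite s \<and> A \<in> \<G>}"
  define r where "r = {((t, B), (s, A)). (t, B) \<in> P \<and> (s, A) \<in> P \<and> s \<subseteq> t \<and> B \<subseteq> A \<and> t - s \<subseteq> A}"
  have r: "((t, B), (s, A)) \<in> r \<longleftrightarrow> (t, B) \<in> P \<and> (s, A) \<in> P \<and> s \<subseteq> t \<and> B \<subseteq> A \<and> t - s \<subseteq> A" for s t A B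
    by (auto simp: r_def)
  have "P \<noteq> {}" using False \<F>\<G> by (auto simp: P_def)
  moreover have "partial_order_on P r"
    unfolding partial_order_on_def preorder_on_def
  proof (intro conjI)
    show "r \<subseteq> P \<times> P" by (auto simp: r_def)
    show "refl_on P r" by (auto simp: refl_on_def r_def)
    show "trans r" unfolding trans_def r_def by blast
    show "antisym r" unfolding antisym_def r_def by blast
  qed
  moreover have "ccc_poset P r"
    unfolding ccc_poset_def
  proof (intro allI impI)
    fix X assume X: "X \<subseteq> P" and anti: "\<forall>p\<in>X. \<forall>q\<in>X. p \<noteq> q \<longrightarrow> \<not> compatible_in P r p q"
    have "inj_on fst X"
    proof (rule inj_onI)
      fix p q assume pq: "p \<in> X" "q \<in> X" "fst p = fst q"
      obtain s A B where AB: "p = (s, A)" "q = (s, B)" using pq(3) by (metis prod.collapse)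
      then have "(s, A \<inter> B) \<in> P" using X pq \<G>_Int by (auto simp: P_def)
      then have "compatible_in P r p q"
        unfolding compatible_in_def AB using X pq AB by (intro bexI[of _ "(s, A \<inter> B)"]) (auto simp: r)
      then show "p = q" using anti pq by blast
    qed
    moreover have "fst ` X \<subseteq> Collect finite" using X by (auto simp: P_def)
    then have "countable (fst ` X)" using countable_Collect_finite countable_subset by metis
    ultimately show "countable X" using countable_image_inj_on by blast
  qed
  moreover
  \<comment> \<open>Meeting \<open>below B\<close> confines all later points to \<open>B\<close>;
    meeting \<open>rect k\<close> puts a rectangle of side \<open>k\<close> into a stem.\<close>
  define below where "below B = {(s, A). (s, A) \<in> P \<and> A \<subseteq> B}" for B
  define rect where "rect k = {(s, A). (s, A) \<in> P \<and> (\<exists>n\<ge>k. has_rect k n s)}" for k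
  have "below ` \<F> \<union> range rect \<prec> (UNIV :: nat set set)"
  proof (rule lesspoll_Un)
    show "infinite (UNIV :: nat set set)" using uncountable_nat_sets countable_finite by blast
    show "below ` \<F> \<prec> (UNIV :: nat set set)" using image_lepoll small lesspoll_trans1 by blast
    show "range rect \<prec> (UNIV :: nat set set)"
      by (rule countable_lesspoll_uncountable[OF _ uncountable_nat_sets]) simp
  qed
  moreover have "\<forall>D\<in>below ` \<F> \<union> range rect. dense_in_poset P r D"
  proof
    fix D assume "D \<in> below ` \<F> \<union> range rect"
    then consider B where "B \<in> \<F>" "D = below B" | k where "D = rect k" by blast
    then show "dense_in_poset P r D"
    proof cases
      case 1
      have "\<exists>d\<in>D. (d, p) \<in> r" if "p \<in> P" for p
      proof -
        obtain s A where p: "p = (s, A)" "finite s" "A \<in> \<G>" using \<open>p \<in> P\<close> unfolding P_def by blast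
        then have "(s, A \<inter> B) \<in> P" using 1(1) \<F>\<G> \<G>_Int by (auto simp: P_def)
        then show ?thesis using that p(1) unfolding 1(2)
          by (intro bexI[of _ "(s, A \<inter> B)"]) (auto simp: r below_def)
      qed
      then show ?thesis unfolding dense_in_poset_def 1(2) by (auto simp: below_def)
    next
      case 2
      have "\<exists>d\<in>D. (d, p) \<in> r" if "p \<in> P" for p
      proof -
        obtain s A where p: "p = (s, A)" "finite s" "A \<in> \<G>" using \<open>p \<in> P\<close> unfolding P_def by blast
        then obtain n where n: "n \<ge> k" "has_rect k n A" using \<G>_large unfolding large_def by blast
        then obtain a b where ab: "finite a" "finite b" "k \<le> card a" "k \<le> card b" "a \<times> b \<subseteq> A"
          "a \<subseteq> block -` {n}" "b \<subseteq> block -` {n}" unfolding has_rect_def by blast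
        then have "has_rect k n (s \<union> a \<times> b)" unfolding has_rect_def by blast
        moreover have "(s \<union> a \<times> b, A) \<in> P" using p ab by (auto simp: P_def)
        ultimately show ?thesis using that p(1) n(1) ab(5) unfolding 2
          by (intro bexI[of _ "(s \<union> a \<times> b, A)"]) (auto simp: r rect_def)
      qed
      then show ?thesis unfolding dense_in_poset_def 2 by (auto simp: rect_def)
    qed
  qed
  ultimately obtain G where G: "filter_in_poset P r G"
    "\<forall>D\<in>below ` \<F> \<union> range rect. G \<inter> D \<noteq> {}"
    using martins_axiomD[OF martins_axiom_pairs[OF MA], of P r "below ` \<F> \<union> range rect"] by blast
  have meets: "\<exists>s A. (s, A) \<in> G \<and> (s, A) \<in> D" if "D \<in> below ` \<F> \<union> range rect" for D
    using G(2) that by (metis disjoint_iff prod.exhaust_sel)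
  define C where "C = \<Union>(fst ` G)"
  have "large C"
    unfolding large_def
  proof
    fix k
    obtain s A where "(s, A) \<in> G" "(s, A) \<in> rect k" using meets[of "rect k"] by blast
    then obtain n where n: "n \<ge> k" "has_rect k n s" and "s \<subseteq> C" by (force simp: rect_def C_def)
    from n(2) \<open>s \<subseteq> C\<close> have "has_rect k n C" by (intro has_rect_mono[of k n s k C]) simp_all
    with n(1) show "\<exists>n\<ge>k. has_rect k n C" by blast
  qed
  moreover have "finite (C - B)" if "B \<in> \<F>" for B
  proof -
    obtain s A where "(s, A) \<in> G" "(s, A) \<in> below B" using meets[of "below B"] \<open>B \<in> \<F>\<close> by blast
    then have sA: "(s, A) \<in> G" "(s, A) \<in> P" "A \<subseteq> B" by (simp_all add: below_def)
    \<comment> \<open>In a common extension of \<open>(s, A)\<close> and the condition that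
      contributes \<open>x\<close>, the point \<open>x\<close> lies in \<open>s\<close> or was added
      from \<open>A \<subseteq> B\<close>.\<close>
    have "C - B \<subseteq> s"
    proof
      fix x assume x: "x \<in> C - B"
      then obtain t A' where t: "(t, A') \<in> G" "x \<in> t" by (auto simp: C_def)
      then obtain u A'' where "((u, A''), (s, A)) \<in> r" "((u, A''), (t, A')) \<in> r"
        using G(1) sA(1) unfolding filter_in_poset_def by (metis surj_pair)
      then show "x \<in> s" using t x sA(3) by (auto simp: r)
    qed
    moreover have "finite s" using sA(2) by (simp add: P_def)
    ultimately show ?thesis using finite_subset by blast
  qed
  ultimately show ?thesis by blast
qed

text \<open>If \<open>A\<close> stays large under all finite intersections of the
  \<open>X n\<close>, a pseudo-intersection works. Otherwise partition regularity at the first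
  failure gives a large set disjoint from the last \<open>X n\<close> used. Constant sequences yield
  ultrafilter decisions, general ones the p-point property.\<close>

lemma large_decides_sequence:
  fixes X :: "nat \<Rightarrow> (nat \<times> nat) set"
  assumes MA: "martins_axiom TYPE(nat set)" and "large A"
  shows "\<exists>B\<subseteq>A. large B \<and> ((\<forall>n. finite (B - X n)) \<or> (\<exists>n. B \<inter> X n = {}))"
proof -
  define B where "B n = A \<inter> (\<Inter>i<n. X i)" for n :: nat
  have B_anti: "B n \<subseteq> B m" if "m \<le> n" for m n using that by (fastforce simp: B_def)
  show ?thesis
  proof (cases "\<forall>n. large (B n)")
    case True
    have "\<exists>C. large C \<and> (\<forall>S\<in>range B. finite (C - S))"
    proof (rule large_pseudo_intersection[OF MA])
      show "range B \<prec> (UNIV :: nat set set)"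
        by (rule countable_lesspoll_uncountable[OF _ uncountable_nat_sets]) simp
      fix S T assume "S \<in> range B" "T \<in> range B"
      then show "finite (S - T) \<or> finite (T - S)"
        using B_anti by (metis Diff_eq_empty_iff finite.emptyI nle_le rangeE)
    qed (use True in auto)
    then obtain C where C: "large C" "\<And>n. finite (C - B n)" by blast
    have "finite (C - A)" using C(2)[of 0] by (simp add: B_def)
    moreover have "C - C \<inter> A = C - A" by blast
    ultimately have "large (C \<inter> A)" using C(1) large_almost_mono by metis
    moreover have "finite (C \<inter> A - X n)" for n
      by (rule finite_subset[OF _ C(2)[of "Suc n"]]) (auto simp: B_def)
    ultimately show ?thesis by (intro exI[of _ "C \<inter> A"]) blast
  next
    case False
    then obtain n where n: "\<not> large (B n)" "\<And>m. m < n \<Longrightarrow> large (B m)"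
      using exists_least_iff[of "\<lambda>n. \<not> large (B n)"] by blast
    have "n \<noteq> 0" using n(1) \<open>large A\<close> by (intro notI) (simp add: B_def)
    then obtain m where m: "n = Suc m" by (cases n) auto
    have "B m = B n \<union> (B m - X m)" by (auto simp: B_def m less_Suc_eq)
    then have "large (B m - X m)" using n large_Un m by (metis lessI)
    moreover have "B m - X m \<subseteq> A" "(B m - X m) \<inter> X m = {}" by (auto simp: B_def)
    ultimately show ?thesis by blast
  qed
qed

subsection \<open>Tukey reductions from p-points\<close>

lemma ultrafilterD:
  assumes "ultrafilter U"
  shows "UNIV \<in> U" "{} \<notin> U" "X \<in> U \<Longrightarrow> X \<subseteq> Y \<Longrightarrow> Y \<in> U"
    "X \<in> U \<Longrightarrow> Y \<in> U \<Longrightarrow> X \<inter> Y \<in> U" "X \<in> U \<or> - X \<in> U"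
  using assms unfolding ultrafilter_def by blast+

lemma pushforward_comp: "pushforward g (pushforward f U) = pushforward (g \<circ> f) U"
  by (simp add: pushforward_def vimage_comp)

lemma image_mem_pushforward:
  assumes "ultrafilter U" "A \<in> U"
  shows "f ` A \<in> pushforward f U"
  unfolding pushforward_def mem_Collect_eq
  by (rule ultrafilterD(3)[OF assms]) blast

lemma ultrafilter_pushforward:
  assumes "ultrafilter U"
  shows "ultrafilter (pushforward f U)"
proof -
  note U = ultrafilterD[OF assms]
  show ?thesis
    unfolding ultrafilter_def pushforward_def mem_Collect_eq
    using U(1,2,4,5) by (auto simp: vimage_Compl intro: U(3)[OF _ vimage_mono])
qed

lemma p_pointD: "p_point U \<Longrightarrow> (\<And>n :: nat. X n \<in> U) \<Longrightarrow> \<exists>Y\<in>U. \<forall>n. finite (Y - X n)"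
  unfolding p_point_def by simp

lemma p_point_pushforward:
  assumes "p_point U" "nonprincipal (pushforward f U)"
  shows "p_point (pushforward f U)"
  unfolding p_point_def
proof (intro conjI allI impI)
  have U: "ultrafilter U" using assms(1) by (simp add: p_point_def)
  show "ultrafilter (pushforward f U)" by (rule ultrafilter_pushforward[OF U])
  fix X :: "nat \<Rightarrow> 'b set" assume "\<forall>n. X n \<in> pushforward f U"
  then have "f -` X n \<in> U" for n by (simp add: pushforward_def)
  then obtain Y where Y: "Y \<in> U" "\<And>n. finite (Y - f -` X n)"
    using p_pointD[OF assms(1), of "\<lambda>n. f -` X n"] by blast
  have "f ` Y \<in> pushforward f U" using Y(1) by (rule image_mem_pushforward[OF U])
  moreover have "finite (f ` Y - X n)" for n
    by (rule finite_subset[OF _ finite_imageI[OF Y(2)[of n], of f]]) auto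
  ultimately show "\<exists>Y\<in>pushforward f U. \<forall>n. finite (Y - X n)" by blast
qed (rule assms(2))

text \<open>Rudin-Keisler reducibility implies Tukey reducibility, witnessed by direct
  images.\<close>

lemma tukey_le_pushforward:
  assumes "ultrafilter U"
  shows "pushforward f U \<le>\<^sub>T U"
  unfolding tukey_le_def
proof (intro bexI[of _ "(`) f"] allI impI)
  show img: "(`) f \<in> U \<rightarrow> pushforward f U"
    using image_mem_pushforward[OF assms] by blast
  fix \<X> assume \<X>: "cofinal_family U \<X>"
  show "cofinal_family (pushforward f U) ((`) f ` \<X>)"
    unfolding cofinal_family_def
  proof (intro conjI ballI)
    show "(`) f ` \<X> \<subseteq> pushforward f U" using img \<X> by (auto simp: cofinal_family_def)
    fix B assume "B \<in> pushforward f U"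
    then obtain X where "X \<in> \<X>" "X \<subseteq> f -` B"
      using \<X> by (auto simp: cofinal_family_def pushforward_def)
    then show "\<exists>Y\<in>(`) f ` \<X>. Y \<subseteq> B" by blast
  qed
qed

lemma tukey_le_trans:
  assumes "W \<le>\<^sub>T V" "V \<le>\<^sub>T U"
  shows "W \<le>\<^sub>T U"
proof -
  obtain f where f: "f \<in> V \<rightarrow> W" "\<And>\<X>. cofinal_family V \<X> \<Longrightarrow> cofinal_family W (f ` \<X>)"
    using assms(1) unfolding tukey_le_def by blast
  obtain g where g: "g \<in> U \<rightarrow> V" "\<And>\<X>. cofinal_family U \<X> \<Longrightarrow> cofinal_family V (g ` \<X>)"
    using assms(2) unfolding tukey_le_def by blast
  have "f \<circ> g \<in> U \<rightarrow> W" using f(1) g(1) by auto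
  moreover have "cofinal_family W ((f \<circ> g) ` \<X>)" if "cofinal_family U \<X>" for \<X>
    using f(2)[OF g(2)[OF that]] by (simp add: image_comp)
  ultimately show ?thesis unfolding tukey_le_def by blast
qed

text \<open>The map \<open>g\<close> joins the values of \<open>f\<close> on all members of
  \<open>U\<close> below the argument.\<close>

lemma tukey_le_monotone_map:
  assumes "ultrafilter U" "ultrafilter V" "V \<le>\<^sub>T U"
  obtains g where "mono g" "\<And>X. X \<in> U \<Longrightarrow> g X \<in> V" "\<And>B. B \<in> V \<Longrightarrow> \<exists>A\<in>U. g A \<subseteq> B"
proof -
  obtain f where f: "f \<in> U \<rightarrow> V" "\<And>\<X>. cofinal_family U \<X> \<Longrightarrow> cofinal_family V (f ` \<X>)"
    using assms(3) unfolding tukey_le_def by blast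
  define g where "g X = \<Union>(f ` {Y \<in> U. Y \<subseteq> X})" for X
  have "mono g" unfolding g_def by (intro monoI) auto
  moreover have "g X \<in> V" if "X \<in> U" for X
    by (rule ultrafilterD(3)[OF assms(2), of "f X"]) (use f(1) that in \<open>auto simp: g_def\<close>)
  moreover have "\<exists>A\<in>U. g A \<subseteq> B" if B: "B \<in> V" for B
  proof (rule ccontr)
    assume none: "\<not> ?thesis"
    \<comment> \<open>If no \<open>g A\<close> is below \<open>B\<close>, then below every
      \<open>A \<in> U\<close> there is a \<open>Y \<in> U\<close> with \<open>f Y\<close> not below
      \<open>B\<close>. The image of this cofinal family would have to contain a set below
      \<open>B\<close>.\<close>
    have "cofinal_family U {Y \<in> U. \<not> f Y \<subseteq> B}"
      unfolding cofinal_family_def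
    proof (intro conjI ballI)
      fix A assume "A \<in> U"
      then have "\<not> g A \<subseteq> B" using none by blast
      then show "\<exists>X\<in>{Y \<in> U. \<not> f Y \<subseteq> B}. X \<subseteq> A" unfolding g_def by blast
    qed blast
    then have "cofinal_family V (f ` {Y \<in> U. \<not> f Y \<subseteq> B})" by (rule f(2))
    then show False using B unfolding cofinal_family_def by blast
  qed
  ultimately show ?thesis using that by blast
qed

section \<open>Coding monotone maps by reals\<close>

text \<open>A monotone map determined by finite parts of its argument. The lists stand for finite
  sets; as \<open>R\<close> lives on a countable type, there are only continuum many such
  maps.\<close>

definition decode :: "(nat list \<times> nat) set \<Rightarrow> nat set \<Rightarrow> nat set" where
  "decode R Y = {k. \<exists>l. set l \<subseteq> Y \<and> (l, k) \<in> R}"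

lemma mono_decode: "mono (decode R)"
  by (intro monoI) (auto simp: decode_def)

text \<open>Iterating \<open>h\<close> cuts the naturals into intervals. The union \<open>E\<close>
  of the even-numbered intervals misses the odd ones and its complement misses the even ones; one of
  these two sets is in \<open>U\<close>.\<close>

lemma ultrafilter_with_gaps:
  fixes h :: "nat \<Rightarrow> nat"
  assumes U: "ultrafilter U" and h: "\<And>m. m < h m"
  shows "\<exists>Z\<in>U. \<forall>k. \<exists>m>k. Z \<inter> {m..<h m} = {}"
proof -
  define n where "n i = (h ^^ i) 0" for i
  have n_Suc: "n (Suc i) = h (n i)" for i by (simp add: n_def)
  have n: "strict_mono n" by (simp add: strict_mono_Suc_iff n_Suc h)
  define E where "E = (\<Union>i. {n (2 * i)..<n (Suc (2 * i))})"
  have disj: "{n i..<n (Suc i)} \<inter> {n j..<n (Suc j)} = {}" if "i < j" for i j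
    using strict_mono_less_eq[OF n, of "Suc i" j] that by auto
  have ne: "{n i..<n (Suc i)} \<inter> {n j..<n (Suc j)} = {}" if "i \<noteq> j" for i j
    using disj[of i j] disj[of j i] that by (metis Int_commute nat_neq_iff)
  have big: "k < n i" if "k < i" for k i
    using strict_mono_imp_increasing[OF n, of i] that by linarith
  have "\<exists>m>k. E \<inter> {m..<h m} = {}" for k
  proof (intro exI[of _ "n (Suc (2 * k))"] conjI)
    have "{n (2 * i)..<n (Suc (2 * i))} \<inter> {n (Suc (2 * k))..<n (Suc (Suc (2 * k)))} = {}" for i
      by (rule ne) presburger
    then show "E \<inter> {n (Suc (2 * k))..<h (n (Suc (2 * k)))} = {}"
      unfolding E_def n_Suc[symmetric] by blast
  qed (rule big, simp)
  moreover have "\<exists>m>k. - E \<inter> {m..<h m} = {}" for k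
  proof (intro exI[of _ "n (2 * Suc k)"] conjI)
    have "{n (2 * Suc k)..<n (Suc (2 * Suc k))} \<subseteq> E" unfolding E_def by blast
    then show "- E \<inter> {n (2 * Suc k)..<h (n (2 * Suc k))} = {}"
      unfolding n_Suc[symmetric] by blast
  qed (rule big, simp)
  ultimately show ?thesis using ultrafilterD(5)[OF U, of E] by blast
qed

text \<open>
  Monotone maps on a p-point are continuous on a cone (Dobrinen--Todorcevic). For every
  pair \<open>(s, k)\<close> for which some \<open>W\<close> in the ultrafilter forces \<open>k \<notin> g (s \<union> W)\<close>, fix such a
  \<open>W s k\<close>. A pseudo-intersection of all \<open>W s k\<close> with sufficiently long gaps decides
  \<open>k \<in> g Y\<close> from the part of \<open>Y\<close> before a gap above \<open>k\<close>.
\<close>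

lemma tukey_le_decode:
  fixes U V :: "nat set set"
  assumes pp: "p_point U" and V: "ultrafilter V" and le: "V \<le>\<^sub>T U"
  shows "\<exists>R. (\<forall>Y\<in>U. decode R Y \<in> V) \<and> (\<forall>B\<in>V. \<exists>Y\<in>U. decode R Y \<subseteq> B)"
proof -
  have U: "ultrafilter U" using pp by (simp add: p_point_def)
  note UD = ultrafilterD[OF U]
  obtain g where g: "mono g" "\<And>X. X \<in> U \<Longrightarrow> g X \<in> V" "\<And>B. B \<in> V \<Longrightarrow> \<exists>A\<in>U. g A \<subseteq> B"
    using tukey_le_monotone_map[OF U V le] by blast
  define R where "R = {(l, k). \<forall>W\<in>U. k \<in> g (set l \<union> W)}"
  \<comment> \<open>If \<open>(l, k) \<in> R\<close>, any member of \<open>U\<close> serves as a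
    default value.\<close>
  have "\<exists>W. W \<in> U \<and> ((l, k) \<notin> R \<longrightarrow> k \<notin> g (set l \<union> W))" for l k
    using UD(1) unfolding R_def by blast
  then obtain W where W: "\<And>l k. W l k \<in> U" "\<And>l k. (l, k) \<notin> R \<Longrightarrow> k \<notin> g (set l \<union> W l k)"
    by metis
  have "case_prod W (from_nat i) \<in> U" for i using W(1) by (auto split: prod.split)
  then obtain X where X: "X \<in> U" "\<And>i. finite (X - case_prod W (from_nat i))"
    using p_pointD[OF pp, of "\<lambda>i. case_prod W (from_nat i)"] by blast
  have XW: "finite (X - W l k)" for l k
    using X(2)[of "to_nat (l, k)"] by simp
  \<comment> \<open>Only finitely many pairs \<open>s\<close>, \<open>k\<close> lie below
    \<open>m\<close>, so beyond some \<open>h\<close> the set \<open>X\<close> is inside all their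
    \<open>W\<close> at once.\<close>
  have "\<exists>h>m. \<forall>s\<subseteq>{..<m}. \<forall>k<m. X - {..<h} \<subseteq> W (sorted_list_of_set s) k" for m
  proof -
    define F where "F = (\<Union>s\<in>Pow {..<m}. \<Union>k<m. X - W (sorted_list_of_set s) k)"
    have "finite F" unfolding F_def by (intro finite_UN_I XW) simp_all
    then obtain b where b: "\<forall>x\<in>F. x < b"
      using finite_nat_set_iff_bounded by blast
    show ?thesis
    proof (intro exI[of _ "Suc (b + m)"] conjI allI impI subsetI)
      fix s k x assume "s \<subseteq> {..<m}" "k < m" "x \<in> X - {..<Suc (b + m)}"
      then have "x \<notin> F" "x \<in> X" using b by auto
      then show "x \<in> W (sorted_list_of_set s) k"
        using \<open>s \<subseteq> {..<m}\<close> \<open>k < m\<close> unfolding F_def by blast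
    qed simp
  qed
  then obtain h where h: "\<And>m. m < h m"
    "\<And>m s k. s \<subseteq> {..<m} \<Longrightarrow> k < m \<Longrightarrow> X - {..<h m} \<subseteq> W (sorted_list_of_set s) k"
    by metis
  obtain Z where Z: "Z \<in> U" "\<And>k. \<exists>m>k. Z \<inter> {m..<h m} = {}"
    using ultrafilter_with_gaps[OF U h(1)] by blast
  have below: "decode R Y \<subseteq> g Y" if "Y \<in> U" for Y
  proof
    fix k assume "k \<in> decode R Y"
    then obtain l where "set l \<subseteq> Y" "(l, k) \<in> R" by (auto simp: decode_def)
    then show "k \<in> g Y" using that unfolding R_def by (auto simp: Un_absorb1)
  qed
  have above: "g Y \<subseteq> decode R Y" if Y: "Y \<subseteq> X \<inter> Z" for Y
  proof
    fix k assume k: "k \<in> g Y"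
    obtain m where m: "k < m" "Z \<inter> {m..<h m} = {}" using Z(2) by blast
    define l where "l = sorted_list_of_set (Y \<inter> {..<m})"
    have l: "set l = Y \<inter> {..<m}" by (simp add: l_def)
    have "Y \<subseteq> set l \<union> W l k"
    proof
      fix y assume y: "y \<in> Y"
      show "y \<in> set l \<union> W l k"
      proof (cases "y < m")
        case True
        then show ?thesis using y l by simp
      next
        case False
        then have "\<not> y < h m" using y Y m(2) by auto
        then have "y \<in> X - {..<h m}" using y Y by auto
        then show ?thesis using h(2)[of "Y \<inter> {..<m}" m k] m(1) unfolding l_def by blast
      qed
    qed
    then have "k \<in> g (set l \<union> W l k)" using k monoD[OF g(1)] by blast
    then have "(l, k) \<in> R" using W(2) by blast
    then show "k \<in> decode R Y" using l by (auto simp: decode_def)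
  qed
  have "decode R Y \<in> V" if "Y \<in> U" for Y
  proof -
    have "Y \<inter> (X \<inter> Z) \<in> U" using that X(1) Z(1) UD(4) by blast
    then have "g (Y \<inter> (X \<inter> Z)) \<in> V" by (rule g(2))
    moreover have "g (Y \<inter> (X \<inter> Z)) \<subseteq> decode R Y"
      using above[of "Y \<inter> (X \<inter> Z)"] monoD[OF mono_decode, of "Y \<inter> (X \<inter> Z)" Y R] by blast
    ultimately show ?thesis using ultrafilterD(3)[OF V] by blast
  qed
  moreover have "\<exists>Y\<in>U. decode R Y \<subseteq> B" if "B \<in> V" for B
    using g(3)[OF that] below by blast
  ultimately show ?thesis by blast
qed

subsection \<open>The generic p-point\<close>

text \<open>Transfinite recursion of length continuum: stage \<open>i\<close> takes a large
  pseudo-intersection of the earlier stages and shrinks it to satisfy \<open>Q i\<close>.\<close>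

lemma large_tower:
  fixes Q :: "nat set \<Rightarrow> (nat \<times> nat) set \<Rightarrow> bool"
  assumes MA: "martins_axiom TYPE(nat set)"
    and step: "\<And>i A. large A \<Longrightarrow> \<exists>B\<subseteq>A. large B \<and> Q i B"
  obtains T where "\<And>i. large (T i)" "\<And>i. Q i (T i)"
    "\<And>i j. finite (T i - T j) \<or> finite (T j - T i)"
proof -
  \<comment> \<open>In a cardinal order every proper initial segment is smaller than the continuum,
    which is what the pseudo-intersection step requires.\<close>
  define c where "c = card_of (UNIV :: nat set set)"
  have c: "wf (c - Id)" "total_on UNIV c" "trans c"
    using card_of_well_order_on[of "UNIV :: nat set set"] unfolding c_def
    by (auto simp: well_order_on_def linear_order_on_def partial_order_on_def preorder_on_def)
  define P where "P T i B \<longleftrightarrow> large B \<and> Q i B \<and> (\<forall>j. (j, i) \<in> c - Id \<longrightarrow> finite (B - T j))" for T i B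
  have "\<exists>T. \<forall>i. P T i (T i)"
  proof (rule dependent_wf_choice[OF c(1)])
    show "P T i B = P T' i B" if "\<And>j. (j, i) \<in> c - Id \<Longrightarrow> T j = T' j" for T T' i B
      using that by (auto simp: P_def)
    fix i T assume IH: "\<And>j. (j, i) \<in> c - Id \<Longrightarrow> P T j (T j)"
    have "\<exists>C. large C \<and> (\<forall>A\<in>T ` underS c i. finite (C - A))"
    proof (rule large_pseudo_intersection[OF MA])
      have "underS c i \<prec> (UNIV :: nat set set)"
        unfolding lesspoll_iff_ordLess c_def
        by (rule card_of_underS[OF card_of_Card_order]) (simp add: Field_card_of)
      then show "T ` underS c i \<prec> (UNIV :: nat set set)"
        using image_lepoll lesspoll_trans1 by blast
      show "large A" if "A \<in> T ` underS c i" for A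
        using that IH by (auto simp: underS_def P_def)
      fix A B assume "A \<in> T ` underS c i" "B \<in> T ` underS c i"
      then obtain j k where jk: "A = T j" "B = T k" "(j, i) \<in> c - Id" "(k, i) \<in> c - Id"
        by (auto simp: underS_def)
      consider "j = k" | "(j, k) \<in> c - Id" | "(k, j) \<in> c - Id"
        using c(2) unfolding total_on_def by blast
      then show "finite (A - B) \<or> finite (B - A)"
        by cases (use jk IH in \<open>auto simp: P_def\<close>)
    qed
    then obtain C where C: "large C" "\<And>j. (j, i) \<in> c - Id \<Longrightarrow> finite (C - T j)"
      by (auto simp: underS_def)
    obtain B where B: "B \<subseteq> C" "large B" "Q i B" using step[OF C(1)] by blast
    have "finite (B - T j)" if "(j, i) \<in> c - Id" for j
      by (rule finite_subset[OF _ C(2)[OF that]]) (use B(1) in blast)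
    then show "\<exists>B. P T i B" using B by (auto simp: P_def)
  qed
  then obtain T where T: "\<And>i. P T i (T i)" by blast
  have "finite (T i - T j) \<or> finite (T j - T i)" for i j
  proof -
    consider "i = j" | "(i, j) \<in> c - Id" | "(j, i) \<in> c - Id"
      using c(2) unfolding total_on_def by blast
    then show ?thesis by cases (use T in \<open>auto simp: P_def\<close>)
  qed
  with T that show ?thesis unfolding P_def by metis
qed

text \<open>A reduction would be coded by some \<open>R\<close>, and the two alternatives of
  \<open>avoids\<close> refute that \<open>decode R\<close> maps into the second projection or that
  its values are cofinal there.\<close>

lemma not_tukey_le_projections:
  fixes D :: "(nat \<times> nat) set set"
  assumes D: "ultrafilter D" and large: "\<And>A. A \<in> D \<Longrightarrow> large A"
    and pp: "p_point (pushforward fst D)"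
    and avoids: "\<And>R. \<exists>A\<in>D. avoids (decode R) A"
  shows "\<not> pushforward snd D \<le>\<^sub>T pushforward fst D"
proof
  assume le: "pushforward snd D \<le>\<^sub>T pushforward fst D"
  let ?U = "pushforward fst D" and ?V = "pushforward snd D"
  have V: "ultrafilter ?V" using D by (rule ultrafilter_pushforward)
  obtain R where R: "\<And>Y. Y \<in> ?U \<Longrightarrow> decode R Y \<in> ?V"
      "\<And>B. B \<in> ?V \<Longrightarrow> \<exists>Y\<in>?U. decode R Y \<subseteq> B"
    using tukey_le_decode[OF pp V le] by blast
  obtain A where A: "A \<in> D" "avoids (decode R) A" using avoids by blast
  have fstA: "fst ` A \<in> ?U" and sndA: "snd ` A \<in> ?V"
    unfolding pushforward_def mem_Collect_eq
    by (rule ultrafilterD(3)[OF D A(1)], force)+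
  from A(2) consider "decode R (fst ` A) \<inter> snd ` A = {}"
    | "\<And>Y. large (A \<inter> Y \<times> UNIV) \<Longrightarrow> \<not> decode R Y \<subseteq> snd ` A"
    unfolding avoids_def by blast
  then show False
  proof cases
    case 1
    then show False
      using ultrafilterD(4)[OF V R(1)[OF fstA] sndA] ultrafilterD(2)[OF V] by simp
  next
    case 2
    obtain Y where Y: "Y \<in> ?U" "decode R Y \<subseteq> snd ` A" using R(2)[OF sndA] by blast
    then have "fst -` Y \<in> D" by (simp add: pushforward_def)
    then have "A \<inter> fst -` Y \<in> D" using A(1) ultrafilterD(4)[OF D] by blast
    moreover have "fst -` Y = Y \<times> (UNIV :: nat set)" by auto
    ultimately have "large (A \<inter> Y \<times> UNIV)" using large by simp
    then show False using 2 Y(2) by blast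
  qed
qed

lemma exists_generic_p_point:
  assumes MA: "martins_axiom TYPE(nat set)"
  obtains D where "p_point D" "\<And>A. A \<in> D \<Longrightarrow> large A"
    "\<And>R. \<exists>A\<in>D. avoids (decode R) A \<and> avoids (decode R) (prod.swap ` A)"
proof -
  \<comment> \<open>One index \<open>i\<close> codes both a sequence of sets and a relation. Both
    codings are onto, so the tower meets every requirement.\<close>
  define sq :: "nat set \<Rightarrow> nat \<Rightarrow> (nat \<times> nat) set"
    where "sq i n = {z. to_nat (n, z) \<in> i}" for i n
  define code :: "nat set \<Rightarrow> (nat list \<times> nat) set" where "code i = {z. to_nat z \<in> i}" for i
  have sq_surj: "\<exists>i. sq i = X" for X
  proof
    show "sq {to_nat (n, z) | n z. z \<in> X n} = X" by (auto simp: sq_def)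
  qed
  have code_surj: "\<exists>i. code i = R" for R
  proof
    show "code (to_nat ` R) = R" by (auto simp: code_def)
  qed
  define Q where "Q i B \<longleftrightarrow> ((\<forall>n. finite (B - sq i n)) \<or> (\<exists>n. B \<inter> sq i n = {})) \<and>
    avoids (decode (code i)) B \<and> avoids (decode (code i)) (prod.swap ` B)" for i B
  have step: "\<exists>B\<subseteq>A. large B \<and> Q i B" if "large A" for i A
  proof -
    let ?g = "decode (code i)"
    obtain A1 where A1: "A1 \<subseteq> A" "large A1"
        "(\<forall>n. finite (A1 - sq i n)) \<or> (\<exists>n. A1 \<inter> sq i n = {})"
      using large_decides_sequence[OF MA \<open>large A\<close>] by blast
    obtain A2 where A2: "A2 \<subseteq> A1" "large A2" "avoids ?g A2"
      using large_avoids[OF A1(2) mono_decode] by blast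
    \<comment> \<open>The opposite direction between the projections is treated on the swapped set
      and then swapped back.\<close>
    obtain A3 where A3: "A3 \<subseteq> prod.swap ` A2" "large A3" "avoids ?g A3"
      using large_avoids[OF large_swap[OF A2(2)] mono_decode] by blast
    let ?B = "prod.swap ` A3"
    have swap: "prod.swap ` ?B = A3" by (simp add: image_image)
    have B: "?B \<subseteq> A2" using A3(1) by auto
    have "finite (?B - sq i n)" if "finite (A1 - sq i n)" for n
      by (rule finite_subset[OF _ that]) (use B A2(1) in blast)
    moreover have "?B \<inter> sq i n = {}" if "A1 \<inter> sq i n = {}" for n
      using that B A2(1) by blast
    ultimately have "Q i ?B"
      unfolding Q_def swap using A1(3) A3(3) avoids_subset[OF mono_decode A2(3) B] by blast
    moreover have "?B \<subseteq> A" using B A2(1) A1(1) by blast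
    ultimately show ?thesis using large_swap[OF A3(2)] by blast
  qed
  obtain T where T: "\<And>i. large (T i)" "\<And>i. Q i (T i)"
    "\<And>i j. finite (T i - T j) \<or> finite (T j - T i)"
    using large_tower[of Q, OF MA step] by blast
  define D where "D = {X. \<exists>i. finite (T i - X)}"
  have TD: "T i \<in> D" for i
  proof -
    have "finite (T i - T i)" by simp
    then show ?thesis unfolding D_def by blast
  qed
  have D_large: "large A" if "A \<in> D" for A
    using that T(1) large_almost_mono by (auto simp: D_def)
  have D_Int: "X \<inter> Y \<in> D" if XY: "X \<in> D" "Y \<in> D" for X Y
  proof -
    obtain i j where ij: "finite (T i - X)" "finite (T j - Y)" using XY by (auto simp: D_def)
    from T(3)[of i j] show ?thesis
    proof
      assume "finite (T i - T j)"
      then have "finite (T i - Y)" using ij(2) almost_subset_trans by blast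
      then have "finite (T i - X \<inter> Y)" using ij(1) by (simp add: Diff_Int)
      then show ?thesis by (auto simp: D_def)
    next
      assume "finite (T j - T i)"
      then have "finite (T j - X)" using ij(1) almost_subset_trans by blast
      then have "finite (T j - X \<inter> Y)" using ij(2) by (simp add: Diff_Int)
      then show ?thesis by (auto simp: D_def)
    qed
  qed
  have D_mono: "Y \<in> D" if XY: "X \<in> D" "X \<subseteq> Y" for X Y
  proof -
    obtain i where "finite (T i - X)" using XY(1) by (auto simp: D_def)
    then have "finite (T i - Y)" by (rule finite_subset[rotated]) (use XY(2) in blast)
    then show ?thesis by (auto simp: D_def)
  qed
  have not_empty: "{} \<notin> D"
    using D_large not_large_singleton[of "{}"] by auto
  have D_seq: "\<exists>i. (\<forall>n. finite (T i - X n)) \<or> (\<exists>n. T i \<inter> X n = {})" for X :: "nat \<Rightarrow> _"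
    using T(2) sq_surj[of X] unfolding Q_def by blast
  have D_compl: "X \<in> D \<or> - X \<in> D" for X
  proof -
    obtain i where "finite (T i - X) \<or> T i \<inter> X = {}" using D_seq[of "\<lambda>_. X"] by blast
    moreover have "- X \<in> D" if "T i \<inter> X = {}"
      by (rule D_mono[OF TD[of i]]) (use that in blast)
    ultimately show ?thesis by (auto simp: D_def)
  qed
  have "ultrafilter D"
    unfolding ultrafilter_def
  proof (intro conjI ballI allI impI)
    show "UNIV \<in> D" by (rule D_mono[OF TD]) simp
  qed (use not_empty D_mono D_Int D_compl in blast)+
  moreover have "nonprincipal D"
    unfolding nonprincipal_def
  proof
    fix z :: "nat \<times> nat"
    have "{z} \<inter> {fst z} \<times> UNIV = {z}" by (cases z) auto
    then show "{z} \<notin> D" using not_large_singleton[of "{z}" "fst z"] D_large by auto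
  qed
  moreover have "\<exists>Y\<in>D. \<forall>n. finite (Y - X n)" if X: "\<forall>n. X n \<in> D" for X :: "nat \<Rightarrow> _"
  proof -
    obtain i where i: "(\<forall>n. finite (T i - X n)) \<or> (\<exists>n. T i \<inter> X n = {})" using D_seq by blast
    \<comment> \<open>This excludes the alternative that \<open>T i\<close> is disjoint from some
      \<open>X n\<close>.\<close>
    have "T i \<inter> X n \<in> D" for n using D_Int TD X by blast
    then have "T i \<inter> X n \<noteq> {}" for n using not_empty by metis
    then show ?thesis using i TD by blast
  qed
  ultimately have "p_point D" unfolding p_point_def by blast
  moreover have "\<exists>A\<in>D. avoids (decode R) A \<and> avoids (decode R) (prod.swap ` A)" for R
    using T(2) code_surj[of R] TD unfolding Q_def by blast
  ultimately show ?thesis using D_large that by blast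
qed

section \<open>The projections and their common image\<close>

theorem theorem57:
  assumes "martins_axiom TYPE(nat set)"
  shows "\<exists>D :: (nat \<times> nat) set set.
    p_point D \<and>
    p_point (pushforward fst D) \<and> p_point (pushforward snd D) \<and>
    tukey_incomparable (pushforward fst D) (pushforward snd D) \<and>
    pushforward fst D <\<^sub>T D \<and> pushforward snd D <\<^sub>T D \<and>
    (\<exists>E :: nat set set. p_point E \<and> E <\<^sub>T pushforward fst D \<and> E <\<^sub>T pushforward snd D)"
proof -
  obtain D where pp: "p_point D" and large: "\<And>A. A \<in> D \<Longrightarrow> large A"
    and avoids: "\<And>R. \<exists>A\<in>D. avoids (decode R) A \<and> avoids (decode R) (prod.swap ` A)"
    by (rule exists_generic_p_point[OF assms]) (rule that)
  have D: "ultrafilter D" using pp by (simp add: p_point_def)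
  note DD = ultrafilterD[OF D]
  let ?U = "pushforward fst D" and ?V = "pushforward snd D"
  \<comment> \<open>The swapped ultrafilter exchanges the two projections, so facts about the first
    projection apply to the second.\<close>
  let ?S = "pushforward prod.swap D"
  have U: "ultrafilter ?U" and V: "ultrafilter ?V" and S: "ultrafilter ?S"
    using D by (simp_all add: ultrafilter_pushforward)
  have S_fst: "pushforward fst ?S = ?V" and S_snd: "pushforward snd ?S = ?U"
    by (simp_all add: pushforward_comp comp_def)
  have swap_in: "prod.swap ` A \<in> ?S" if "A \<in> D" for A
    using that by (simp add: pushforward_def inj_vimage_image_eq)
  have S_large: "large A" if "A \<in> ?S" for A
  proof -
    have "prod.swap -` A = prod.swap ` A" by force
    then have "large (prod.swap ` A)" using that large by (simp add: pushforward_def)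
    from large_swap[OF this] show ?thesis by (simp add: image_image)
  qed
  have "nonprincipal ?U"
    unfolding nonprincipal_def pushforward_def
  proof (intro allI notI, unfold mem_Collect_eq)
    fix x assume "fst -` {x} \<in> D"
    moreover have "fst -` {x} = UNIV \<inter> {x} \<times> (UNIV :: nat set)" by auto
    ultimately show False using large not_large_singleton by metis
  qed
  then have ppU: "p_point ?U" by (rule p_point_pushforward[OF pp])
  have "nonprincipal (pushforward fst ?S)"
    unfolding nonprincipal_def pushforward_def[of fst]
  proof (intro allI notI, unfold mem_Collect_eq)
    fix x assume "fst -` {x} \<in> ?S"
    moreover have "fst -` {x} = UNIV \<inter> {x} \<times> (UNIV :: nat set)" by auto
    ultimately show False using S_large not_large_singleton by metis
  qed
  then have ppV: "p_point ?V" unfolding S_fst by (rule p_point_pushforward[OF pp])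
  have VU: "\<not> ?V \<le>\<^sub>T ?U"
    using not_tukey_le_projections[OF D large ppU] avoids by blast
  have UV: "\<not> ?U \<le>\<^sub>T ?V"
    using not_tukey_le_projections[OF S S_large] ppV avoids swap_in unfolding S_fst S_snd by blast
  have UD: "?U \<le>\<^sub>T D" and VD: "?V \<le>\<^sub>T D" using D by (simp_all add: tukey_le_pushforward)
  define E where "E = pushforward block ?U"
  \<comment> \<open>On this set \<open>block \<circ> fst\<close> and
    \<open>block \<circ> snd\<close> agree, so both projections have the same image \<open>E\<close>
    under \<open>block\<close>.\<close>
  have "{z. block (fst z) = block (snd z)} \<in> D"
  proof -
    have "- {z. block (fst z) = block (snd z)} \<notin> D"
      using large not_large_off_diagonal by (auto simp: Collect_neg_eq)
    then show ?thesis using DD(5) by blast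
  qed
  then have block_eq: "(block \<circ> fst) -` X \<in> D \<longleftrightarrow> (block \<circ> snd) -` X \<in> D" for X
    using DD(4)[of _ "{z. block (fst z) = block (snd z)}"]
    by (smt (verit, best) DD(3) IntE comp_apply mem_Collect_eq subsetI vimageE vimageI)
  then have EV: "E = pushforward block ?V" by (simp add: E_def pushforward_comp) (simp add: pushforward_def)
  have "nonprincipal E"
    unfolding nonprincipal_def
  proof (intro allI notI)
    fix n assume "{n} \<in> E"
    then have "{z. block (fst z) = n} \<in> D"
      by (simp add: E_def pushforward_def vimage_def)
    then show False using large not_large_fibre by blast
  qed
  then have ppE: "p_point E" using p_point_pushforward[OF ppU] by (simp add: E_def)
  have EU: "E \<le>\<^sub>T ?U" unfolding E_def by (rule tukey_le_pushforward[OF U])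
  have EV: "E \<le>\<^sub>T ?V" unfolding EV by (rule tukey_le_pushforward[OF V])
  have "tukey_incomparable ?U ?V" using UV VU by (simp add: tukey_incomparable_def)
  \<comment> \<open>A reverse reduction, from \<open>D\<close> to one projection or from one
    projection to \<open>E\<close>, would compose with the reductions at hand to make the two
    projections comparable.\<close>
  moreover have "?U <\<^sub>T D" "?V <\<^sub>T D" "E <\<^sub>T ?U" "E <\<^sub>T ?V"
    unfolding tukey_less_def using UD VD EU EV UV VU tukey_le_trans by blast+
  ultimately show ?thesis using pp ppU ppV ppE by blast
qed

end
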